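(* Let $n>0$ be odd, let $S_n$ be the $n\times n$ $0/1$-matrix defined recursively in the context, and let $F_j$ denote the Fibonacci numbers ($F_1=F_2=1$, $F_j=F_{j-1}+F_{j-2}$ for $j\ge3$). Then the equation $S_n\mathbf{z}=\mathbf{1}$ has the unique solution $$\mathbf{z}=\left(\frac{F_{n-1}}{F_n},\frac{F_{n-2}}{F_n},\ldots,\frac{F_2}{F_n},\frac{F_1}{F_n},\frac{1}{F_n}\right)$$ (for $n=1$ this reads $\mathbf{z}=(1/F_1)=(1)$). Consequently, for a set $E$ with $|E|=n$, $S_n$ is the incidence matrix of a cover of $E$ whose corresponding CAR mechanism is an extreme CAR mechanism, and the height of the uniform multicover generating this mechanism is $k=F_n$.
   Context: The matrices $S_n$ are defined inductively by $S_1=(1)$; for odd $n$, $$S_{n+1}=\begin{pmatrix}1&\mathbf{0}^\top\\ \mathbf{0}&S_n\end{pmatrix},$$ and for even $n$, $$S_{n+1}=\begin{pmatrix}0&\mathbf{1}^\top\\ \mathbf{1}&S_n\end{pmatrix},$$ where $\mathbf{0}$ and $\mathbf{1}$ are the column vectors of all zeros and all ones of the appropriate length. Let $E$ be a finite nonempty set. A CAR (coarsening at random) mechanism on $E$ is a vector of real numbers $\boldsymbol{\pi}=(\pi_A:\varnothing\neq A\subseteq E)$ such that $\pi_A\ge 0$ for all $A$ and $\sum_{A\ni x}\pi_A=1$ for every $x\in E$. A cover of $E$ is a collection $(A_1,\ldots,A_m)$ of distinct nonempty subsets of $E$ whose union is $E$. Its incidence matrix $M$ is the matrix with rows indexed by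 $x\in E$, columns indexed by $j=1,\ldots,m$, and entries $1$ if $x\in A_j$ and $0$ otherwise. If $M\mathbf{z}=\mathbf{1}$ has a nonnegative solution $\mathbf{z}=(z_1,\ldots,z_m)$, the CAR mechanism corresponding to it is given by $\pi_{A_j}=z_j$ for $j=1,\ldots,m$ and $\pi_A=0$ for every $A$ not in the cover. A CAR mechanism is called extreme if it corresponds to the incidence matrix $M$ of a cover of $E$ such that $M\mathbf{z}=\mathbf{1}$ has a unique solution $\mathbf{z}\in\mathbb{R}^m$, and this solution is strictly positive. A uniform multicover of $E$ of height $k$ (integer $k\ge 1$) is a family of nonnegative integers $(n_A)_{\varnothing\ne A\subseteq E}$ with $\sum_{A\ni x}n_A=k$ for every $x\in E$. It generates the CAR mechanism $\pi_A=n_A/k$. Multicovers that generate the same mechanism are identified, and the one with the smallest $k$ is taken as representative; so "the height of the uniform multicover generating $\boldsymbol{\pi}$" means the smallest integer $k\ge1$ such that $k\pi_A$ is an integer for all $A$. *)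

theory Defs
  imports Complex_Main "HOL-Number_Theory.Fib" "Jordan_Normal_Form.Matrix"
begin

(* The value at 0 is a placeholder: the recursion starts at n = 1. *)
fun S_mat :: "nat \<Rightarrow> real mat" where
  "S_mat 0 = 0\<^sub>m 0 0"
| "S_mat (Suc 0) = mat 1 1 (\<lambda>_. 1)"
| "S_mat (Suc (Suc m)) =
     (if odd (Suc m)
      then four_block_mat (mat 1 1 (\<lambda>_. 1)) (mat 1 (Suc m) (\<lambda>_. 0))
                          (mat (Suc m) 1 (\<lambda>_. 0)) (S_mat (Suc m))
      else four_block_mat (mat 1 1 (\<lambda>_. 0)) (mat 1 (Suc m) (\<lambda>_. 1))
                          (mat (Suc m) 1 (\<lambda>_. 1)) (S_mat (Suc m)))"

definition ones_vec :: "nat \<Rightarrow> real vec" where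
  "ones_vec n = vec n (\<lambda>_. 1)"

(* Indices start at 0, so this is (F_(n-1), F_(n-2), ..., F_1, 1) / F_n. *)
definition fib_ratio_vec :: "nat \<Rightarrow> real vec" where
  "fib_ratio_vec n =
     vec n (\<lambda>i. if i < n - 1 then real (fib (n - 1 - i)) / real (fib n)
                 else 1 / real (fib n))"

(* A family indexed by the nonempty subsets of E is a function on all sets;
   its values at other arguments are never consulted. *)
definition CAR_mechanism :: "'a set \<Rightarrow> ('a set \<Rightarrow> real) \<Rightarrow> bool" where
  "CAR_mechanism E \<pi> \<longleftrightarrow>
     finite E \<and> E \<noteq> {} \<and>
     (\<forall>A. A \<noteq> {} \<and> A \<subseteq> E \<longrightarrow> \<pi> A \<ge> 0) \<and>
     (\<forall>x\<in>E. (\<Sum>A | A \<subseteq> E \<and> x \<in> A. \<pi> A) = 1)"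

definition is_cover :: "'a set \<Rightarrow> 'a set list \<Rightarrow> bool" where
  "is_cover E As \<longleftrightarrow>
     distinct As \<and> (\<forall>A\<in>set As. A \<noteq> {} \<and> A \<subseteq> E) \<and> \<Union>(set As) = E"

definition enumerates :: "'a list \<Rightarrow> 'a set \<Rightarrow> bool" where
  "enumerates xs E \<longleftrightarrow> distinct xs \<and> set xs = E"

(* The list xs enumerates the ground set and thereby orders the rows. *)
definition incidence_mat :: "'a list \<Rightarrow> 'a set list \<Rightarrow> real mat" where
  "incidence_mat xs As =
     mat (length xs) (length As) (\<lambda>(i, j). if xs ! i \<in> As ! j then 1 else 0)"

definition ones_solutions :: "real mat \<Rightarrow> real vec set" where
  "ones_solutions M = {z \<in> carrier_vec (dim_col M). M *\<^sub>v z = ones_vec (dim_row M)}"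

(* For distinct As: the j-th set gets weight z $ j, every other set gets 0. *)
definition cover_mechanism :: "'a set list \<Rightarrow> real vec \<Rightarrow> 'a set \<Rightarrow> real" where
  "cover_mechanism As z A =
     (if A \<in> set As then z $ (THE j. j < length As \<and> As ! j = A) else 0)"

(* The choice of xs only permutes the equations, so it does not matter
   which enumeration of E is used. *)
definition extreme_CAR_mechanism :: "'a set \<Rightarrow> ('a set \<Rightarrow> real) \<Rightarrow> bool" where
  "extreme_CAR_mechanism E \<pi> \<longleftrightarrow>
     CAR_mechanism E \<pi> \<and>
     (\<exists>xs As z. enumerates xs E \<and> is_cover E As \<and>
        ones_solutions (incidence_mat xs As) = {z} \<and>
        (\<forall>j<length As. z $ j > 0) \<and>
        (\<forall>A. A \<noteq> {} \<and> A \<subseteq> E \<longrightarrow> \<pi> A = cover_mechanism As z A))"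

definition uniform_multicover :: "'a set \<Rightarrow> nat \<Rightarrow> ('a set \<Rightarrow> nat) \<Rightarrow> bool" where
  "uniform_multicover E k c \<longleftrightarrow>
     k \<ge> 1 \<and> (\<forall>x\<in>E. (\<Sum>A | A \<subseteq> E \<and> x \<in> A. c A) = k)"

definition multicover_generates ::
    "'a set \<Rightarrow> nat \<Rightarrow> ('a set \<Rightarrow> nat) \<Rightarrow> ('a set \<Rightarrow> real) \<Rightarrow> bool" where
  "multicover_generates E k c \<pi> \<longleftrightarrow>
     (\<forall>A. A \<noteq> {} \<and> A \<subseteq> E \<longrightarrow> \<pi> A = real (c A) / real k)"

definition multicover_height :: "'a set \<Rightarrow> ('a set \<Rightarrow> real) \<Rightarrow> nat" where
  "multicover_height E \<pi> =
     (LEAST k. k \<ge> 1 \<and> (\<forall>A. A \<noteq> {} \<and> A \<subseteq> E \<longrightarrow> real k * \<pi> A \<in> \<int>))"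

end

theory Submission
  imports Defs
begin

text \<open>
  For odd \<open>n\<close> the system \<open>S\<^bsub>n+2\<^esub> z = c \<cdot> 1\<close> with \<open>z = (a, b, w)\<close> reads \<open>b + \<Sum>w = c\<close>, \<open>a + b = c\<close> and
  \<open>S\<^sub>n w = (c - a) \<cdot> 1 = b \<cdot> 1\<close>. Inductively, \<open>w\<close> is \<open>b\<close> times the solution for \<open>S\<^sub>n\<close>, whose entries
  sum to \<open>F\<^bsub>n+1\<^esub> / F\<^sub>n\<close>; hence \<open>b = c F\<^sub>n / F\<^bsub>n+2\<^esub>\<close> and \<open>a = c F\<^bsub>n+1\<^esub> / F\<^bsub>n+2\<^esub>\<close>.
  Any \<open>0/1\<close> matrix for which \<open>M z = 1\<close> is uniquely solvable has distinct nonzero columns and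
  nonzero rows, so it is the incidence matrix of a cover. The height is at least \<open>F\<^sub>n\<close> because one
  weight is \<open>1 / F\<^sub>n\<close>.
\<close>

section \<open>Unique solvability and the kernel\<close>

lemma ones_solutions_iff:
  "z \<in> ones_solutions M \<longleftrightarrow>
     dim_vec z = dim_col M \<and> (\<forall>i<dim_row M. (\<Sum>j<dim_col M. M $$ (i, j) * z $ j) = 1)"
proof -
  have "(M *\<^sub>v z = ones_vec (dim_row M)) \<longleftrightarrow>
      (\<forall>i<dim_row M. (\<Sum>j<dim_col M. M $$ (i, j) * z $ j) = 1)"
    if "dim_vec z = dim_col M"
    using that
    by (simp add: vec_eq_iff ones_vec_def scalar_prod_def lessThan_atLeast0)
  then show ?thesis
    unfolding ones_solutions_def carrier_vec_def by blast
qed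

lemma sum_mult_of_bool_index:
  fixes a :: "nat \<Rightarrow> real"
  assumes "j < m"
  shows "(\<Sum>l<m. a l * of_bool (l = j)) = a j"
  using assms by (simp add: of_bool_def if_distrib cong: if_cong)

text \<open>Adding a kernel vector to the solution gives another solution. The kernel vector is a
  plain function, so combinations of unit vectors, written \<open>of_bool (l = j)\<close>, can be
  inserted directly.\<close>

lemma unique_solution_kernel_trivial:
  assumes sol: "ones_solutions M = {z}"
    and ker: "\<And>i. i < dim_row M \<Longrightarrow> (\<Sum>j<dim_col M. M $$ (i, j) * v j) = 0"
    and j: "j < dim_col M"
  shows "v j = 0"
proof -
  have z: "z \<in> ones_solutions M" using sol by simp
  have "vec (dim_col M) (\<lambda>j. z $ j + v j) \<in> ones_solutions M"
    using z ker by (simp add: ones_solutions_iff distrib_left sum.distrib)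
  then have "vec (dim_col M) (\<lambda>j. z $ j + v j) = z" using sol by simp
  then have "vec (dim_col M) (\<lambda>j. z $ j + v j) $ j = z $ j" by simp
  then show ?thesis using j by simp
qed

section \<open>The cover read off from a 0/1 matrix\<close>

text \<open>Meant as the inverse of \<open>incidence_mat xs\<close>: column j becomes the set of
  those points whose row has a 1 there.\<close>

definition column_sets :: "'a list \<Rightarrow> real mat \<Rightarrow> 'a set list" where
  "column_sets xs M =
     map (\<lambda>j. {xs ! i | i. i < length xs \<and> M $$ (i, j) = 1}) [0..<dim_col M]"

lemma length_column_sets [simp]: "length (column_sets xs M) = dim_col M"
  by (simp add: column_sets_def)

lemma nth_mem_column_sets:
  assumes "distinct xs" "i < length xs" "j < dim_col M"
  shows "xs ! i \<in> column_sets xs M ! j \<longleftrightarrow> M $$ (i, j) = 1"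
  using assms by (auto simp: column_sets_def nth_eq_iff_index_eq)

lemma column_sets_subset:
  assumes "j < dim_col M"
  shows "column_sets xs M ! j \<subseteq> set xs"
  using assms by (auto simp: column_sets_def)

context
  fixes xs :: "'a list" and M :: "real mat" and z :: "real vec"
  assumes dist: "distinct xs" and len: "length xs = dim_row M"
    and entries: "\<And>i j. i < dim_row M \<Longrightarrow> j < dim_col M \<Longrightarrow> M $$ (i, j) \<in> {0, 1}"
    and sol: "ones_solutions M = {z}"
begin

lemma incidence_mat_column_sets: "incidence_mat xs (column_sets xs M) = M"
  using entries len dist by (intro eq_matI) (auto simp: incidence_mat_def nth_mem_column_sets)

text \<open>If columns j and k agreed, the difference of the j-th and k-th unit vectors would be a
  nonzero kernel vector.\<close>

lemma distinct_column_sets: "distinct (column_sets xs M)"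
  unfolding distinct_conv_nth
proof (intro allI impI notI)
  fix j k
  assume j: "j < length (column_sets xs M)" and k: "k < length (column_sets xs M)" and "j \<noteq> k"
    and eq: "column_sets xs M ! j = column_sets xs M ! k"
  have "M $$ (i, j) = M $$ (i, k)" if "i < dim_row M" for i
  proof -
    have "M $$ (i, j) = 1 \<longleftrightarrow> M $$ (i, k) = 1"
      using nth_mem_column_sets[OF dist, of i j M] nth_mem_column_sets[OF dist, of i k M] eq j k that len
      by simp
    moreover have "M $$ (i, j) \<in> {0, 1}" "M $$ (i, k) \<in> {0, 1}"
      using entries j k that by simp_all
    ultimately show ?thesis by fastforce
  qed
  then have "(\<Sum>l<dim_col M. M $$ (i, l) * (of_bool (l = j) - of_bool (l = k))) = 0"
    if "i < dim_row M" for i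
    using that j k by (simp add: right_diff_distrib sum_subtractf sum_mult_of_bool_index)
  from unique_solution_kernel_trivial[OF sol this, of j] j \<open>j \<noteq> k\<close> show False
    by simp
qed

text \<open>A zero column would put a unit vector into the kernel.\<close>

lemma column_sets_nonempty:
  assumes "j < dim_col M"
  shows "column_sets xs M ! j \<noteq> {}"
proof
  assume "column_sets xs M ! j = {}"
  then have "M $$ (i, j) = 0" if "i < dim_row M" for i
    using nth_mem_column_sets[OF dist, of i j M] entries[of i j] assms that len by auto
  then have "(\<Sum>l<dim_col M. M $$ (i, l) * of_bool (l = j)) = 0" if "i < dim_row M" for i
    using that assms by (simp add: sum_mult_of_bool_index)
  from unique_solution_kernel_trivial[OF sol this assms] show False
    by simp
qed

lemma solution_row_sum:
  assumes "i < dim_row M"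
  shows "(\<Sum>j<dim_col M. M $$ (i, j) * z $ j) = 1"
  using sol assms ones_solutions_iff[of z M] by auto

lemma is_cover_column_sets: "is_cover (set xs) (column_sets xs M)"
  unfolding is_cover_def
proof (intro conjI ballI)
  show "A \<noteq> {}" "A \<subseteq> set xs" if "A \<in> set (column_sets xs M)" for A
  proof -
    from that obtain j where "j < dim_col M" "A = column_sets xs M ! j"
      by (metis in_set_conv_nth length_column_sets)
    then show "A \<noteq> {}" "A \<subseteq> set xs"
      using column_sets_nonempty column_sets_subset by simp_all
  qed
  then have sub: "\<Union> (set (column_sets xs M)) \<subseteq> set xs" by blast
  show "\<Union> (set (column_sets xs M)) = set xs"
  proof
    show "\<Union> (set (column_sets xs M)) \<subseteq> set xs" by (rule sub)
    show "set xs \<subseteq> \<Union> (set (column_sets xs M))"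
    proof
      fix x assume "x \<in> set xs"
      then obtain i where i: "i < dim_row M" "x = xs ! i" by (auto simp: in_set_conv_nth len)
      \<comment> \<open>The row of x sums to 1 against \<open>z\<close>, so some term is nonzero;
        its matrix entry is then 1 and x lies in that set.\<close>
      obtain j where j: "j < dim_col M" "M $$ (i, j) * z $ j \<noteq> 0"
        using solution_row_sum[OF i(1)] sum.neutral[of "{..<dim_col M}" "\<lambda>j. M $$ (i, j) * z $ j"]
        by force
      then have "x \<in> column_sets xs M ! j"
        using i entries[of i j] nth_mem_column_sets[OF dist, of i j M] len by auto
      then show "x \<in> \<Union> (set (column_sets xs M))"
        using j(1) by (metis UnionI length_column_sets nth_mem)
    qed
  qed
qed (rule distinct_column_sets)

lemma cover_mechanism_nth:
  assumes "j < dim_col M"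
  shows "cover_mechanism (column_sets xs M) z (column_sets xs M ! j) = z $ j"
proof -
  have "(THE k. k < length (column_sets xs M) \<and> column_sets xs M ! k = column_sets xs M ! j) = j"
    using assms distinct_column_sets by (intro the_equality) (auto simp: nth_eq_iff_index_eq)
  then show ?thesis using assms by (auto simp: cover_mechanism_def)
qed

lemma cover_mechanism_cases:
  obtains "cover_mechanism (column_sets xs M) z A = 0"
  | j where "j < dim_col M" "A = column_sets xs M ! j"
      "cover_mechanism (column_sets xs M) z A = z $ j"
proof (cases "A \<in> set (column_sets xs M)")
  case True
  then show ?thesis using that(2) cover_mechanism_nth by (auto simp: in_set_conv_nth)
next
  case False
  then show ?thesis using that(1) by (simp add: cover_mechanism_def)
qed

text \<open>Sets outside the cover have weight 0, so the sum over the sets containing x is the row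
  of x in the system solved by \<open>z\<close>.\<close>

lemma cover_mechanism_point_sum:
  assumes "x \<in> set xs"
  shows "(\<Sum>A | A \<subseteq> set xs \<and> x \<in> A. cover_mechanism (column_sets xs M) z A) = 1"
proof -
  let ?As = "column_sets xs M"
  obtain i where i: "i < dim_row M" "x = xs ! i"
    using assms by (auto simp: in_set_conv_nth len)
  have inj: "inj_on (\<lambda>j. ?As ! j) {..<dim_col M}"
    using distinct_column_sets by (auto simp: inj_on_def nth_eq_iff_index_eq)
  have img: "(\<lambda>j. ?As ! j) ` {..<dim_col M} = set ?As"
    by (auto simp: in_set_conv_nth)
  have sub: "set ?As \<subseteq> Pow (set xs)"
    using is_cover_column_sets by (auto simp: is_cover_def)
  \<comment> \<open>Membership of x becomes a 0/1 factor, which will turn into the matrix entry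
    after reindexing by columns.\<close>
  have "(\<Sum>A | A \<subseteq> set xs \<and> x \<in> A. cover_mechanism ?As z A)
      = (\<Sum>A\<in>Pow (set xs). of_bool (x \<in> A) * cover_mechanism ?As z A)"
    by (rule sum.mono_neutral_cong_left) auto
  also have "\<dots> = (\<Sum>A\<in>set ?As. of_bool (x \<in> A) * cover_mechanism ?As z A)"
    using sub by (intro sum.mono_neutral_right) (auto simp: cover_mechanism_def)
  also have "\<dots> = (\<Sum>j<dim_col M. of_bool (x \<in> ?As ! j) * cover_mechanism ?As z (?As ! j))"
    by (simp add: img[symmetric] sum.reindex[OF inj])
  also have "\<dots> = (\<Sum>j<dim_col M. M $$ (i, j) * z $ j)"
    using i entries nth_mem_column_sets[OF dist] len
    by (intro sum.cong) (auto simp: cover_mechanism_nth)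
  finally show ?thesis using solution_row_sum[OF i(1)] by simp
qed

lemma extreme_CAR_mechanism_column_sets:
  assumes "xs \<noteq> []" and pos: "\<And>j. j < dim_col M \<Longrightarrow> z $ j > 0"
  shows "extreme_CAR_mechanism (set xs) (cover_mechanism (column_sets xs M) z)"
  unfolding extreme_CAR_mechanism_def
proof (intro conjI exI)
  show "CAR_mechanism (set xs) (cover_mechanism (column_sets xs M) z)"
    unfolding CAR_mechanism_def
  proof (intro conjI allI impI ballI)
    fix A show "0 \<le> cover_mechanism (column_sets xs M) z A"
      by (cases A rule: cover_mechanism_cases) (use pos in \<open>auto simp: less_imp_le\<close>)
  qed (use assms(1) cover_mechanism_point_sum in auto)
  show "enumerates xs (set xs)" using dist by (simp add: enumerates_def)
  show "ones_solutions (incidence_mat xs (column_sets xs M)) = {z}"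
    using sol by (simp add: incidence_mat_column_sets)
qed (use is_cover_column_sets pos in auto)

end

section \<open>Uniform multicovers and their height\<close>

lemma CAR_mechanism_multicover:
  assumes car: "CAR_mechanism E \<pi>" and k: "k \<ge> 1"
    and int: "\<And>A. A \<noteq> {} \<Longrightarrow> A \<subseteq> E \<Longrightarrow> real k * \<pi> A \<in> \<int>"
  shows "\<exists>c. uniform_multicover E k c \<and> multicover_generates E k c \<pi>"
proof (intro exI conjI)
  \<comment> \<open>The only possible multiplicities are k times the weights; these are nonnegative
    integers, so rounding down and \<open>nat\<close> lose nothing on nonempty subsets of
    \<open>E\<close>.\<close>
  let ?c = "\<lambda>A. nat \<lfloor>real k * \<pi> A\<rfloor>"
  have c: "real (?c A) = real k * \<pi> A" if "A \<noteq> {}" "A \<subseteq> E" for A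
    using int[OF that] car that by (auto simp: CAR_mechanism_def elim!: Ints_cases)
  show "multicover_generates E k ?c \<pi>"
    using c k by (simp add: multicover_generates_def)
  have "(\<Sum>A | A \<subseteq> E \<and> x \<in> A. ?c A) = k" if "x \<in> E" for x
  proof -
    have "real (\<Sum>A | A \<subseteq> E \<and> x \<in> A. ?c A) = (\<Sum>A | A \<subseteq> E \<and> x \<in> A. real k * \<pi> A)"
      unfolding of_nat_sum by (intro sum.cong refl c) auto
    also have "\<dots> = real k"
      using car that by (simp add: CAR_mechanism_def flip: sum_distrib_left)
    finally show ?thesis by (simp only: of_nat_eq_iff)
  qed
  then show "uniform_multicover E k ?c"
    using k by (simp add: uniform_multicover_def)
qed

text \<open>A weight 1/k makes every admissible height l a positive integer multiple of k, because
  l/k must be an integer.\<close>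

lemma multicover_height_eqI:
  assumes "k \<ge> 1" and "\<And>A. A \<noteq> {} \<Longrightarrow> A \<subseteq> E \<Longrightarrow> real k * \<pi> A \<in> \<int>"
    and B: "B \<noteq> {}" "B \<subseteq> E" "\<pi> B = 1 / real k"
  shows "multicover_height E \<pi> = k"
  unfolding multicover_height_def
proof (rule Least_equality)
  fix l assume l: "1 \<le> l \<and> (\<forall>A. A \<noteq> {} \<and> A \<subseteq> E \<longrightarrow> real l * \<pi> A \<in> \<int>)"
  then obtain m where "real l * \<pi> B = of_int m"
    using B(1,2) Ints_cases by metis
  then have m: "real l = of_int m * real k" using B(3) assms(1) by (simp add: field_simps)
  then have "0 < of_int m * real k" using l by linarith
  then have "m \<ge> 1" using assms(1) by (simp add: zero_less_mult_iff)
  then have "1 * real k \<le> of_int m * real k" by (intro mult_right_mono) auto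
  then show "k \<le> l" using m by simp
qed (use assms in auto)

section \<open>The matrices and their Fibonacci solutions\<close>

lemma dim_S_mat [simp]: "dim_row (S_mat n) = n" "dim_col (S_mat n) = n"
  by (induction n rule: S_mat.induct) auto

lemma S_mat_entries:
  assumes "i < n" "j < n"
  shows "S_mat n $$ (i, j) \<in> {0, 1}"
  using assms
proof (induction n arbitrary: i j rule: S_mat.induct)
  case (3 m)
  then show ?case by (cases i; cases j; cases "odd (Suc m)") (simp_all del: even_Suc)
qed simp_all

text \<open>Two steps of the recursion are unfolded at once, so that an induction can pass from one
  odd size to the next.\<close>

lemma S_mat_odd_step:
  assumes "odd n"
  shows "S_mat (Suc (Suc n)) $$ (0, 0) = 0"
    and "j < Suc n \<Longrightarrow> S_mat (Suc (Suc n)) $$ (0, Suc j) = 1"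
    and "i < Suc n \<Longrightarrow> S_mat (Suc (Suc n)) $$ (Suc i, 0) = 1"
    and "S_mat (Suc (Suc n)) $$ (Suc 0, Suc 0) = 1"
    and "j < n \<Longrightarrow> S_mat (Suc (Suc n)) $$ (Suc 0, Suc (Suc j)) = 0"
    and "i < n \<Longrightarrow> S_mat (Suc (Suc n)) $$ (Suc (Suc i), Suc 0) = 0"
    and "i < n \<Longrightarrow> j < n \<Longrightarrow> S_mat (Suc (Suc n)) $$ (Suc (Suc i), Suc (Suc j)) = S_mat n $$ (i, j)"
proof -
  obtain m where m: "n = Suc m" using assms by (cases n) auto
  have S: "S_mat (Suc (Suc n)) =
      four_block_mat (mat 1 1 (\<lambda>_. 0)) (mat 1 (Suc n) (\<lambda>_. 1)) (mat (Suc n) 1 (\<lambda>_. 1))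
        (four_block_mat (mat 1 1 (\<lambda>_. 1)) (mat 1 n (\<lambda>_. 0)) (mat n 1 (\<lambda>_. 0)) (S_mat n))"
    using assms unfolding m S_mat.simps(3) by simp
  note [simp del] = S_mat.simps
  show "S_mat (Suc (Suc n)) $$ (0, 0) = 0"
    and "j < Suc n \<Longrightarrow> S_mat (Suc (Suc n)) $$ (0, Suc j) = 1"
    and "i < Suc n \<Longrightarrow> S_mat (Suc (Suc n)) $$ (Suc i, 0) = 1"
    and "S_mat (Suc (Suc n)) $$ (Suc 0, Suc 0) = 1"
    and "j < n \<Longrightarrow> S_mat (Suc (Suc n)) $$ (Suc 0, Suc (Suc j)) = 0"
    and "i < n \<Longrightarrow> S_mat (Suc (Suc n)) $$ (Suc (Suc i), Suc 0) = 0"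
    and "i < n \<Longrightarrow> j < n \<Longrightarrow> S_mat (Suc (Suc n)) $$ (Suc (Suc i), Suc (Suc j)) = S_mat n $$ (i, j)"
    by (simp_all add: S)
qed

text \<open>From index 2 on, the vector is the one for \<open>n\<close> with denominator F_(n+2)
  instead of F_n; this includes the last entry, whose numerator is 1.\<close>

lemma fib_ratio_vec_step:
  assumes "n > 0"
  shows "fib_ratio_vec (Suc (Suc n)) $ 0 = fib (Suc n) / fib (Suc (Suc n))"
    and "fib_ratio_vec (Suc (Suc n)) $ Suc 0 = fib n / fib (Suc (Suc n))"
    and "j < n \<Longrightarrow> fib_ratio_vec (Suc (Suc n)) $ Suc (Suc j)
      = fib n / fib (Suc (Suc n)) * fib_ratio_vec n $ j"
  using assms fib_neq_0_nat[of n]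
  by (auto simp: fib_ratio_vec_def less_diff_conv simp del: fib.simps)

lemma sum_fib_ratio_vec:
  assumes "n > 0"
  shows "(\<Sum>j<n. fib_ratio_vec n $ j) = fib (Suc n) / fib n"
proof -
  \<comment> \<open>The extra 1 is the numerator of the last entry of the vector.\<close>
  have fib_sum: "(\<Sum>j<m. fib (m - j)) + 1 = fib (Suc (Suc m))" for m
    by (induction m) (simp_all add: sum.lessThan_Suc_shift del: sum.lessThan_Suc)
  obtain m where m: "n = Suc m" using assms gr0_conv_Suc by auto
  have "(\<Sum>j<n. fib_ratio_vec n $ j) = (\<Sum>j<m. real (fib (m - j)) / fib n) + 1 / fib n"
    by (simp add: m fib_ratio_vec_def)
  also have "\<dots> = real ((\<Sum>j<m. fib (m - j)) + 1) / fib n"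
    by (simp add: add_divide_distrib sum_divide_distrib)
  finally show ?thesis by (simp only: fib_sum m)
qed

text \<open>The right-hand side is scaled by \<open>c\<close> because the induction step needs the scalar \<open>b\<close>.\<close>

lemma S_mat_solve:
  assumes "odd n"
  shows "(\<forall>i<n. (\<Sum>j<n. S_mat n $$ (i, j) * z j) = c) \<longleftrightarrow>
    (\<forall>j<n. z j = c * fib_ratio_vec n $ j)"
  using assms
\<comment> \<open>The induction advances by two, and size 0 is excluded by parity.\<close>
proof (induction n arbitrary: z c rule: induct_nat_012)
  case 1
  then show ?case by (simp add: fib_ratio_vec_def)
next
  case (ge2 n)
  then have n: "odd n" "n > 0" by (auto simp: odd_pos)
  let ?N = "Suc (Suc n)"
  define a b w where "a = z 0" and "b = z 1" and "w = (\<lambda>j. z (Suc (Suc j)))"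
  define F G H where "F = real (fib n)" and "G = real (fib (Suc n))" and "H = real (fib ?N)"
  have FGH: "F > 0" "G > 0" "H = F + G"
    using n fib_neq_0_nat[of n] fib_neq_0_nat[of "Suc n"] by (simp_all add: F_def G_def H_def)
  have all_Suc2: "(\<forall>i<?N. P i) \<longleftrightarrow> P 0 \<and> P (Suc 0) \<and> (\<forall>i<n. P (Suc (Suc i)))" for P
    by (simp add: All_less_Suc2)
  have IH: "(\<forall>i<n. (\<Sum>j<n. S_mat n $$ (i, j) * w j) = c - a) \<longleftrightarrow>
      (\<forall>j<n. w j = (c - a) * fib_ratio_vec n $ j)"
    using ge2.IH(1) n(1) by blast
  \<comment> \<open>Row 0, row 1 and the remaining rows give the three conditions on
    \<open>a\<close>, \<open>b\<close> and \<open>w\<close>.\<close>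
  have "(\<forall>i<?N. (\<Sum>j<?N. S_mat ?N $$ (i, j) * z j) = c) \<longleftrightarrow>
      b + (\<Sum>j<n. w j) = c \<and> a + b = c \<and> (\<forall>i<n. (\<Sum>j<n. S_mat n $$ (i, j) * w j) = c - a)"
    using n by (auto simp: all_Suc2 sum.lessThan_Suc_shift S_mat_odd_step a_def b_def w_def algebra_simps
        simp del: S_mat.simps sum.lessThan_Suc)
  \<comment> \<open>The equation of row 1 turns the scalar \<open>c - a\<close> of the induction
    hypothesis into \<open>b\<close>.\<close>
  also have "\<dots> \<longleftrightarrow> b + (\<Sum>j<n. w j) = c \<and> a + b = c \<and> (\<forall>j<n. w j = b * fib_ratio_vec n $ j)"
    unfolding IH by auto
  also have "\<dots> \<longleftrightarrow> b + b * (G / F) = c \<and> a + b = c \<and> (\<forall>j<n. w j = b * fib_ratio_vec n $ j)"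
    using sum_fib_ratio_vec[OF n(2)] by (auto simp: F_def G_def simp flip: sum_distrib_left)
  also have "\<dots> \<longleftrightarrow> a = c * (G / H) \<and> b = c * (F / H) \<and> (\<forall>j<n. w j = b * fib_ratio_vec n $ j)"
  proof -
    have "b + b * (G / F) = c \<longleftrightarrow> b = c * (F / H)" using FGH by (auto simp: field_simps)
    moreover have "a + c * (F / H) = c \<longleftrightarrow> a = c * (G / H)" using FGH by (auto simp: field_simps)
    ultimately show ?thesis by auto
  qed
  also have "\<dots> \<longleftrightarrow> (\<forall>j<?N. z j = c * fib_ratio_vec ?N $ j)"
    unfolding all_Suc2
    using n by (auto simp: fib_ratio_vec_step a_def b_def w_def F_def G_def H_def simp del: fib.simps)
  finally show ?case .
qed simp

lemma ones_solutions_S_mat: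
  assumes "odd n"
  shows "ones_solutions (S_mat n) = {fib_ratio_vec n}"
proof -
  have "z \<in> ones_solutions (S_mat n) \<longleftrightarrow> z = fib_ratio_vec n" for z
    using S_mat_solve[OF assms, of "\<lambda>j. z $ j" 1]
    by (auto simp: ones_solutions_iff vec_eq_iff fib_ratio_vec_def)
  then show ?thesis by blast
qed

section \<open>Cover, mechanism and height for odd \<open>n\<close>\<close>

theorem theorem3:
  fixes n :: nat
  assumes "n > 0" and "odd n"
  shows "ones_solutions (S_mat n) = {fib_ratio_vec n} \<and>
    (\<forall>(E :: 'a set) xs. card E = n \<and> enumerates xs E \<longrightarrow>
      (\<exists>As. is_cover E As \<and> incidence_mat xs As = S_mat n \<and>
        extreme_CAR_mechanism E (cover_mechanism As (fib_ratio_vec n)) \<and>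
        (\<exists>c. uniform_multicover E (fib n) c \<and>
             multicover_generates E (fib n) c (cover_mechanism As (fib_ratio_vec n))) \<and>
        multicover_height E (cover_mechanism As (fib_ratio_vec n)) = fib n))"
proof (intro conjI allI impI)
  show sol: "ones_solutions (S_mat n) = {fib_ratio_vec n}"
    using assms(2) by (rule ones_solutions_S_mat)
  fix E :: "'a set" and xs
  assume "card E = n \<and> enumerates xs E"
  then have E: "E = set xs" and dist: "distinct xs" and len: "length xs = dim_row (S_mat n)"
    by (auto simp: enumerates_def distinct_card)
  have entries: "S_mat n $$ (i, j) \<in> {0, 1}" if "i < dim_row (S_mat n)" "j < dim_col (S_mat n)" for i j
    using S_mat_entries that by simp
  \<comment> \<open>These four facts discharge the assumptions of the context on 0/1
    matrices.\<close>
  note cover = dist len entries sol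
  let ?As = "column_sets xs (S_mat n)"
  let ?\<pi> = "cover_mechanism ?As (fib_ratio_vec n)"
  have fib: "fib n \<ge> 1"
    using fib_neq_0_nat[OF assms(1)] by simp
  have weight: "fib_ratio_vec n $ j > 0" "real (fib n) * fib_ratio_vec n $ j \<in> \<int>" if "j < n" for j
    using that fib fib_neq_0_nat[of "n - 1 - j"] by (auto simp: fib_ratio_vec_def)
  have int: "real (fib n) * ?\<pi> A \<in> \<int>" for A
    by (rule cover_mechanism_cases[OF cover, of A]) (use weight in auto)
  have extreme: "extreme_CAR_mechanism E ?\<pi>"
    unfolding E
    by (rule extreme_CAR_mechanism_column_sets[OF cover]) (use assms(1) len weight in auto)
  \<comment> \<open>The last column carries the weight 1/F_n, also when \<open>n\<close> is 1; this
    weight bounds the height from below.\<close>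
  have last: "n - 1 < dim_col (S_mat n)" using assms(1) by simp
  have "multicover_height E ?\<pi> = fib n"
  proof (rule multicover_height_eqI[OF fib int])
    show "?As ! (n - 1) \<noteq> {}" by (rule column_sets_nonempty[OF cover last])
    show "?As ! (n - 1) \<subseteq> E" unfolding E by (rule column_sets_subset[OF last])
    have "?\<pi> (?As ! (n - 1)) = fib_ratio_vec n $ (n - 1)"
      by (rule cover_mechanism_nth[OF cover last])
    then show "?\<pi> (?As ! (n - 1)) = 1 / real (fib n)"
      using assms(1) by (simp add: fib_ratio_vec_def)
  qed
  moreover have "\<exists>c. uniform_multicover E (fib n) c \<and> multicover_generates E (fib n) c ?\<pi>"
    using extreme fib int by (intro CAR_mechanism_multicover) (auto simp: extreme_CAR_mechanism_def)
  moreover have "is_cover E ?As" unfolding E by (rule is_cover_column_sets[OF cover])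
  moreover have "incidence_mat xs ?As = S_mat n" by (rule incidence_mat_column_sets[OF cover])
  ultimately show "\<exists>As. is_cover E As \<and> incidence_mat xs As = S_mat n \<and>
        extreme_CAR_mechanism E (cover_mechanism As (fib_ratio_vec n)) \<and>
        (\<exists>c. uniform_multicover E (fib n) c \<and>
             multicover_generates E (fib n) c (cover_mechanism As (fib_ratio_vec n))) \<and>
        multicover_height E (cover_mechanism As (fib_ratio_vec n)) = fib n"
    using extreme by blast
qed

end
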